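(* Let $\bigoplus_{\mathbb{Z}}\mathbb{Z}$ be the free abelian group of countably infinite rank with free basis $\{e_i\mid i\in\mathbb{Z}\}$, and let $\mathbf{c}=(c_i)_{i\in\mathbb{Z}}$ be given by $$c_i=\begin{cases}\sum_{k=1}^{i}e_k&\text{for } i>0,\\ 0&\text{for } i=0,\\ \sum_{k=1}^{-i}-e_{1-k}&\text{for } i<0.\end{cases}$$ Then each indecomposable multipermutation solution of level at most $2$ is a homomorphic image of the solution $\mathcal{S}\bigl((\bigoplus_{\mathbb{Z}}\mathbb{Z})\times\mathbb{Z},\mathbf{c}\bigr)$.
   Context: A solution (set-theoretic, non-degenerate, involutive solution of the Yang-Baxter equation) is a triple $(X,\sigma,\tau)$ with $X$ a non-empty set and $\sigma,\tau\colon X^2\to X$ such that, writing $\sigma_x=\sigma(x,\cdot)$ and $\tau_y=\tau(\cdot,y)$, the map $r(x,y)=(\sigma_x(y),\tau_y(x))$ is a bijection of $X^2$ satisfying $(\mathrm{id}\times r)(r\times \mathrm{id})(\mathrm{id}\times r)=(r\times \mathrm{id})(\mathrm{id}\times r)(r\times \mathrm{id})$, all $\sigma_x,\tau_y$ are bijections, and $r^2=\mathrm{id}$. It is indecomposable if the permutation group $\mathcal{G}(X)=\langle\sigma_x\mid x\in X\rangle$ acts transitively on $X$. Put $x\sim y$ iff $\tau_x=\tau_y$. The quotient $X/{\sim}$ carries an induced solution, the retraction $\mathrm{Ret}(X)$. The solution has multipermutation level $1$ if $|\mathrm{Ret}(X)|=1$, and level $2$ if $|\mathrm{Ret}(X)|>1$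 and $|\mathrm{Ret}(\mathrm{Ret}(X))|=1$. For an abelian group $G$ and a sequence $\mathbf{c}=(c_i)_{i\in\mathbb{Z}}$ in $G$ with $c_0=0$ whose members generate $G$, $\mathcal{S}(G\times\mathbb{Z},\mathbf{c})$ denotes the solution $(G\times\mathbb{Z},\sigma,\tau)$ with $\sigma_{(a,i)}((b,j))=(b+c_{i-j-1}-c_{-j-1},j+1)$ and $\tau_{(a,i)}((b,j))=(b-c_{i-j+1}+c_{-j},j-1)$. A homomorphism from $(X,\sigma,\tau)$ to $(X',\sigma',\tau')$ is a map $\Phi\colon X\to X'$ with $\Phi\sigma_x=\sigma'_{\Phi(x)}\Phi$ for all $x\in X$; $(X',\sigma',\tau')$ is a homomorphic image of $(X,\sigma,\tau)$ if there is a surjective homomorphism $X\to X'$. *)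

theory Defs
  imports
    "HOL-Algebra.Group_Action"
    "HOL-Algebra.Generated_Groups"
    "HOL-Computational_Algebra.Group_Closure"
    "HOL-Library.Poly_Mapping"
begin

section \<open>Solutions of the Yang-Baxter equation\<close>

text \<open>
  In both fields the index of the permutation comes first: \<open>sigma S x y\<close> is
  $\sigma_x(y) = \sigma(x,y)$, and \<open>tau S y x\<close> is $\tau_y(x) = \tau(x,y)$.
\<close>

record 'a ybe = "'a partial_object" +
  sigma :: "'a \<Rightarrow> 'a \<Rightarrow> 'a"
  tau :: "'a \<Rightarrow> 'a \<Rightarrow> 'a"

definition ybe_map :: "'a ybe \<Rightarrow> 'a \<times> 'a \<Rightarrow> 'a \<times> 'a"
  where "ybe_map S = (\<lambda>(x, y). (sigma S x y, tau S y x))"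

text \<open>$r \times \mathrm{id}$ and $\mathrm{id} \times r$ on triples.\<close>

definition apply12 :: "('a \<times> 'a \<Rightarrow> 'a \<times> 'a) \<Rightarrow> 'a \<times> 'a \<times> 'a \<Rightarrow> 'a \<times> 'a \<times> 'a"
  where "apply12 r = (\<lambda>(x, y, z). (fst (r (x, y)), snd (r (x, y)), z))"

definition apply23 :: "('a \<times> 'a \<Rightarrow> 'a \<times> 'a) \<Rightarrow> 'a \<times> 'a \<times> 'a \<Rightarrow> 'a \<times> 'a \<times> 'a"
  where "apply23 r = (\<lambda>(x, y, z). (x, r (y, z)))"

locale ybe_solution =
  fixes S :: "'a ybe"
  assumes nonempty: "carrier S \<noteq> {}"
    and bij_ybe_map: "bij_betw (ybe_map S) (carrier S \<times> carrier S) (carrier S \<times> carrier S)"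
    and braid: "\<And>t. t \<in> carrier S \<times> carrier S \<times> carrier S \<Longrightarrow>
      apply23 (ybe_map S) (apply12 (ybe_map S) (apply23 (ybe_map S) t)) =
      apply12 (ybe_map S) (apply23 (ybe_map S) (apply12 (ybe_map S) t))"
    and bij_sigma: "\<And>x. x \<in> carrier S \<Longrightarrow> bij_betw (sigma S x) (carrier S) (carrier S)"
    and bij_tau: "\<And>y. y \<in> carrier S \<Longrightarrow> bij_betw (tau S y) (carrier S) (carrier S)"
    and involutive: "\<And>p. p \<in> carrier S \<times> carrier S \<Longrightarrow> ybe_map S (ybe_map S p) = p"

text \<open>
  The elements of \<^term>\<open>BijGroup X\<close> are the permutations of \<open>X\<close> that are \<open>undefined\<close>
  outside \<open>X\<close>; hence the restriction.
\<close>

definition permutation_group :: "'a ybe \<Rightarrow> ('a \<Rightarrow> 'a) monoid"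
  where "permutation_group S = (BijGroup (carrier S))
    \<lparr>carrier := generate (BijGroup (carrier S))
       ((\<lambda>x. restrict (sigma S x) (carrier S)) ` carrier S)\<rparr>"

definition indecomposable :: "'a ybe \<Rightarrow> bool"
  where "indecomposable S \<longleftrightarrow> transitive_action (permutation_group S) (carrier S) (\<lambda>g. g)"


section \<open>Retraction and multipermutation level\<close>

definition ret_rel :: "'a ybe \<Rightarrow> ('a \<times> 'a) set"
  where "ret_rel S = {(x, y). x \<in> carrier S \<and> y \<in> carrier S \<and>
    (\<forall>z \<in> carrier S. tau S x z = tau S y z)}"

text \<open>
  The operations on classes are $\sigma_{[x]}([y]) = [\sigma_x(y)]$ and
  $\tau_{[y]}([x]) = [\tau_y(x)]$. As the relation is a congruence of a solution, each union
  below is over copies of one and the same class.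
\<close>

definition retraction :: "'a ybe \<Rightarrow> 'a set ybe"
  where "retraction S =
    \<lparr>carrier = carrier S // ret_rel S,
     sigma = (\<lambda>A B. \<Union>x\<in>A. \<Union>y\<in>B. ret_rel S `` {sigma S x y}),
     tau = (\<lambda>B A. \<Union>y\<in>B. \<Union>x\<in>A. ret_rel S `` {tau S y x})\<rparr>"

definition mp_level_1 :: "'a ybe \<Rightarrow> bool"
  where "mp_level_1 S \<longleftrightarrow> card (carrier (retraction S)) = 1"

text \<open>As \<^const>\<open>card\<close> is \<open>0\<close> on infinite sets, these have to be admitted separately.\<close>

definition mp_level_2 :: "'a ybe \<Rightarrow> bool"
  where "mp_level_2 S \<longleftrightarrow>
    (infinite (carrier (retraction S)) \<or> card (carrier (retraction S)) > 1) \<and>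
    card (carrier (retraction (retraction S))) = 1"


section \<open>Homomorphisms\<close>

definition ybe_hom :: "'a ybe \<Rightarrow> 'b ybe \<Rightarrow> ('a \<Rightarrow> 'b) \<Rightarrow> bool"
  where "ybe_hom S S' \<Phi> \<longleftrightarrow> \<Phi> \<in> carrier S \<rightarrow> carrier S' \<and>
    (\<forall>x \<in> carrier S. \<forall>y \<in> carrier S. \<Phi> (sigma S x y) = sigma S' (\<Phi> x) (\<Phi> y))"

definition homomorphic_image :: "'b ybe \<Rightarrow> 'a ybe \<Rightarrow> bool"
  where "homomorphic_image S' S \<longleftrightarrow> (\<exists>\<Phi>. ybe_hom S S' \<Phi> \<and> \<Phi> ` carrier S = carrier S')"


section \<open>The solutions \<open>\<S>(G \<times> \<int>, c)\<close>\<close>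

text \<open>
  The formulas make sense for every sequence \<open>c\<close> in \<open>G\<close>. The standing requirements that
  \<open>c 0 = 0\<close> and that the members of \<open>c\<close> generate \<open>G\<close> are verified for the sequence
  of interest in \<open>free_seq_0\<close> and \<open>free_seq_generates\<close>.
\<close>

definition seq_solution :: "(int \<Rightarrow> 'g::ab_group_add) \<Rightarrow> ('g \<times> int) ybe"
  where "seq_solution c =
    \<lparr>carrier = UNIV,
     sigma = (\<lambda>(a, i) (b, j). (b + c (i - j - 1) - c (- j - 1), j + 1)),
     tau = (\<lambda>(a, i) (b, j). (b - c (i - j + 1) + c (- j), j - 1))\<rparr>"

lemma ybe_solution_seq_solution: "ybe_solution (seq_solution c)"
proof -
  let ?S = "seq_solution c"
  have inv: "ybe_map ?S (ybe_map ?S p) = p" for p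
    by (cases p) (auto simp: ybe_map_def seq_solution_def algebra_simps)
  have sig: "bij (sigma ?S x)" for x
    by (rule o_bij[where g = "\<lambda>(b, j). (b - c (snd x - j) + c (- j), j - 1)"])
       (auto simp: seq_solution_def fun_eq_iff algebra_simps split: prod.splits)
  have tau: "bij (tau ?S x)" for x
    by (rule o_bij[where g = "\<lambda>(b, j). (b + c (snd x - j) - c (- j - 1), j + 1)"])
       (auto simp: seq_solution_def fun_eq_iff algebra_simps split: prod.splits)
  show ?thesis
  proof
    show "bij_betw (ybe_map ?S) (carrier ?S \<times> carrier ?S) (carrier ?S \<times> carrier ?S)"
      using involuntory_imp_bij[OF inv] by (simp add: seq_solution_def)
    show "apply23 (ybe_map ?S) (apply12 (ybe_map ?S) (apply23 (ybe_map ?S) t)) =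
      apply12 (ybe_map ?S) (apply23 (ybe_map ?S) (apply12 (ybe_map ?S) t))" for t
      by (cases t) (auto simp: apply12_def apply23_def ybe_map_def seq_solution_def algebra_simps)
  qed (use inv sig tau in \<open>auto simp: seq_solution_def\<close>)
qed


section \<open>The sequence in the free abelian group\<close>

text \<open>
  $\bigoplus_{\mathbb{Z}} \mathbb{Z}$ is the type \<^typ>\<open>int \<Rightarrow>\<^sub>0 int\<close> of finitely supported
  functions, with basis $e_i =$ \<^term>\<open>frag_of i\<close>.
\<close>

definition free_seq :: "int \<Rightarrow> (int \<Rightarrow>\<^sub>0 int)"
  where "free_seq i =
    (if i > 0 then \<Sum>k = 1..i. frag_of k
     else if i = 0 then 0
     else \<Sum>k = 1..- i. - frag_of (1 - k))"

lemma free_seq_0: "free_seq 0 = 0"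
  by (simp add: free_seq_def)

lemma free_seq_diff: "free_seq i - free_seq (i - 1) = frag_of i"
proof (cases "i > 0")
  case True
  then have "{1..i} = insert i {1..i - 1}" by auto
  with True show ?thesis by (auto simp: free_seq_def)
next
  case False
  then have "{1..1 - i} = insert (1 - i) {1..- i}" by auto
  with False show ?thesis by (auto simp: free_seq_def)
qed

lemma free_seq_generates: "group_closure (range free_seq) = UNIV"
proof -
  have "x \<in> group_closure (range free_seq)" for x
  proof (rule frag_induction[where S = UNIV])
    show "frag_of i \<in> group_closure (range free_seq)" for i
      unfolding free_seq_diff[of i, symmetric] by (intro group_closure.intros) auto
  qed (auto intro: group_closure.diff)
  then show ?thesis by blast
qed

end

theory Submission
  imports Defs "HOL-Algebra.Free_Abelian_Groups"
begin

text \<open>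
  If the level is at most 2, all $\sigma_x$ induce one and the same permutation of the retraction,
  and by indecomposability a single cycle of it. So with $x_i = \sigma_e^i(e)$ every $\sigma_y$ is
  some $s_i = \sigma_{x_i}$, and the braid relation becomes $s_i s_j = s_{j+1} s_{i-1}$. It follows
  that the permutations $s_i s_j^{-1}$ commute, so $e_i \mapsto s_i s_{i-1}^{-1}$ defines a
  homomorphism $\alpha$ on $\bigoplus_{\mathbb{Z}} \mathbb{Z}$, and
  $(b, j) \mapsto s_0^j(\alpha(b)(e))$ is the required epimorphism.
\<close>

section \<open>Exchange relations and maps out of the free abelian group\<close>

text \<open>Centralizers are subgroups. The fact \<open>gen\<close> is used twice: first each
  generator commutes with \<open>a\<close>, and then \<open>a\<close> commutes with
  \<open>b\<close>.\<close>

lemma (in group) generate_commute: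
  assumes K: "K \<subseteq> carrier G" and comm: "\<And>x y. x \<in> K \<Longrightarrow> y \<in> K \<Longrightarrow> x \<otimes> y = y \<otimes> x"
    and "a \<in> generate G K" "b \<in> generate G K"
  shows "a \<otimes> b = b \<otimes> a"
proof -
  have mult: "u \<otimes> (x \<otimes> y) = (x \<otimes> y) \<otimes> u"
    if "u \<otimes> x = x \<otimes> u" "u \<otimes> y = y \<otimes> u" "u \<in> carrier G" "x \<in> carrier G" "y \<in> carrier G" for u x y
    using that by (metis m_assoc)
  have inv: "u \<otimes> inv x = inv x \<otimes> u"
    if "u \<otimes> x = x \<otimes> u" "u \<in> carrier G" "x \<in> carrier G" for u x
    using that by (metis inv_closed inv_solve_left inv_solve_right m_assoc m_closed)
  have gen: "u \<otimes> x = x \<otimes> u"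
    if x: "x \<in> generate G K" and u: "u \<in> carrier G" and K': "\<And>k. k \<in> K \<Longrightarrow> u \<otimes> k = k \<otimes> u" for u x
    using x
  proof induction
    case (eng x y)
    then show ?case using mult u K generate_in_carrier by blast
  qed (use u K K' inv in auto)
  show ?thesis
  proof (rule gen)
    show "a \<otimes> k = k \<otimes> a" if "k \<in> K" for k
      using gen[OF assms(3), of k] that K comm by force
  qed (use assms generate_in_carrier in auto)
qed

text \<open>
  Conjugation by any \<open>s k\<close> shifts both indices of \<open>s i \<otimes> inv (s j)\<close> by one. As the effect does
  not depend on \<open>k\<close>, these elements commute with each other, so that the free abelian group maps
  to the subgroup that they generate.
\<close>

lemma (in group) exchange_sequence_hom:
  fixes s :: "int \<Rightarrow> 'a"
  assumes s: "\<And>i. s i \<in> carrier G" and rel: "\<And>i j. s i \<otimes> s j = s (j + 1) \<otimes> s (i - 1)"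
  obtains \<alpha> where "\<alpha> \<in> hom (free_Abelian_group UNIV) G"
    and "\<And>i. \<alpha> (frag_of i) = s i \<otimes> inv (s (i - 1))"
    and "\<And>i j. s i \<otimes> s 0 [^] j =
      s 0 [^] (j + 1) \<otimes> \<alpha> (free_seq (i - j - 1) - free_seq (- j - 1))"
proof -
  define D where "D i j = s i \<otimes> inv (s j)" for i j
  have D[simp]: "D i j \<in> carrier G" for i j
    by (simp add: D_def s)
  have D_mult: "D i j \<otimes> D j k = D i k" for i j k
    unfolding D_def using s by (metis inv_closed inv_solve_left m_assoc m_closed)
  have D_s: "D i j \<otimes> s j = s i" for i j
    by (simp add: D_def s m_assoc)
  have shift: "D i j \<otimes> s k = s k \<otimes> D (i - 1) (j - 1)" for i j k
  proof -
    \<comment> \<open>The relation reads \<open>s i\<close> times \<open>s (k - 1)\<close> =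
      \<open>s k\<close> times \<open>s (i - 1)\<close>. Writing \<open>s (i - 1)\<close> as
      \<open>D (i - 1) (k - 1)\<close> times \<open>s (k - 1)\<close>, the last factor
      cancels.\<close>
    have eq: "s i = s k \<otimes> D (i - 1) (k - 1)" for i k
    proof -
      have "s i \<otimes> s (k - 1) = s k \<otimes> D (i - 1) (k - 1) \<otimes> s (k - 1)"
        using rel[of i "k - 1"] s by (simp add: m_assoc D_s)
      then show ?thesis
        using s by simp
    qed
    have "D i j \<otimes> s k = D i j \<otimes> s j \<otimes> D (k - 1) (j - 1)"
      using eq[of k j] s by (simp add: m_assoc)
    also have "\<dots> = s k \<otimes> D (i - 1) (k - 1) \<otimes> D (k - 1) (j - 1)"
      by (simp only: D_s eq[of i k, symmetric])
    finally show ?thesis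
      using s by (simp add: m_assoc D_mult)
  qed
  have comm: "D i j \<otimes> D k l = D k l \<otimes> D i j" for i j k l
  proof -
    have "D i j \<otimes> D k l \<otimes> s l = D i j \<otimes> s k"
      by (simp add: D_s m_assoc s)
    also have "\<dots> = D k l \<otimes> s l \<otimes> D (i - 1) (j - 1)"
      by (simp only: shift[of i j k] D_s)
    also have "\<dots> = D k l \<otimes> D i j \<otimes> s l"
      by (simp add: shift[of i j l] m_assoc s)
    finally show ?thesis
      using s by simp
  qed
  \<comment> \<open>For negative exponents the induction goes downwards and ends by cancelling a
    factor \<open>s 0\<close> on the right.\<close>
  have shift_pow: "D i j \<otimes> s 0 [^] n = s 0 [^] n \<otimes> D (i - n) (j - n)" for i j n
  proof (induction n rule: int_induct[where k = 0])
    case (step1 n)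
    have "D i j \<otimes> s 0 [^] (n + 1) = s 0 [^] n \<otimes> (D (i - n) (j - n) \<otimes> s 0)"
      using step1 s by (simp add: int_pow_mult m_assoc[symmetric])
    also have "\<dots> = s 0 [^] (n + 1) \<otimes> D (i - (n + 1)) (j - (n + 1))"
      using s by (simp add: shift int_pow_mult m_assoc diff_diff_eq)
    finally show ?case .
  next
    case (step2 n)
    have p: "s 0 [^] n = s 0 [^] (n - 1) \<otimes> s 0"
      using s int_pow_mult[of "s 0" "n - 1" 1] by simp
    have "D i j \<otimes> s 0 [^] (n - 1) \<otimes> s 0 = s 0 [^] (n - 1) \<otimes> (s 0 \<otimes> D (i - n) (j - n))"
      using step2 s by (simp add: p m_assoc)
    also have "\<dots> = s 0 [^] (n - 1) \<otimes> D (i - (n - 1)) (j - (n - 1)) \<otimes> s 0"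
      using s shift[of "i - (n - 1)" "j - (n - 1)" 0] by (simp add: m_assoc algebra_simps)
    finally show ?case
      using s by simp
  qed (simp add: s)
  \<comment> \<open>The universal property needs a commutative target, which \<open>G\<close> need
    not be; hence the detour through this subgroup.\<close>
  let ?H = "subgroup_generated G (range (\<lambda>(i, j). D i j))"
  interpret H: comm_group ?H
  proof (rule group.group_comm_groupI)
    fix x y
    assume "x \<in> carrier ?H" "y \<in> carrier ?H"
    then show "x \<otimes>\<^bsub>?H\<^esub> y = y \<otimes>\<^bsub>?H\<^esub> x"
      unfolding mult_subgroup_generated carrier_subgroup_generated
      by (rule generate_commute[rotated 2]) (auto simp: comm)
  qed simp
  have "(\<lambda>i. D i (i - 1)) ` UNIV \<subseteq> carrier ?H"
    by (auto simp: carrier_subgroup_generated intro!: generate.incl)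
  then obtain \<alpha> where \<alpha>: "\<alpha> \<in> hom (free_Abelian_group UNIV) ?H"
    and \<alpha>_frag: "\<And>i. \<alpha> (frag_of i) = D i (i - 1)"
    by (rule H.free_Abelian_group_universal) auto
  have hom: "\<alpha> \<in> hom (free_Abelian_group UNIV) G"
    using \<alpha> carrier_subgroup_generated_subset by (auto simp: hom_def Pi_def)
  interpret \<alpha>: group_hom "free_Abelian_group UNIV" G \<alpha>
    by (simp add: group_hom_def group_hom_axioms_def hom is_group)
  have \<alpha>_closed [simp]: "\<alpha> x \<in> carrier G" for x
    using \<alpha>.hom_closed[of x] by simp
  have \<alpha>_add: "\<alpha> (x + y) = \<alpha> x \<otimes> \<alpha> y" for x y
    using \<alpha>.hom_mult[of x y] by simp
  \<comment> \<open>Consecutive members of \<open>free_seq\<close> differ by a basis element, so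
    their images telescope, starting from \<open>free_seq 0 = 0\<close>.\<close>
  have \<alpha>_seq: "\<alpha> (free_seq i) = D i 0" for i
  proof (induction i rule: int_induct[where k = 0])
    case base
    then show ?case
      using \<alpha>.hom_one s by (simp add: free_seq_0 D_def)
  next
    case (step1 i)
    then show ?case
      using \<alpha>_add[of "frag_of (i + 1)" "free_seq i"] free_seq_diff[of "i + 1"]
      by (simp add: algebra_simps \<alpha>_frag D_mult)
  next
    case (step2 i)
    have "D i (i - 1) \<otimes> \<alpha> (free_seq (i - 1)) = D i (i - 1) \<otimes> D (i - 1) 0"
      using step2 \<alpha>_add[of "frag_of i" "free_seq (i - 1)"] free_seq_diff[of i]
      by (simp add: algebra_simps \<alpha>_frag D_mult)
    then show ?case
      by simp
  qed
  have \<alpha>_diff: "\<alpha> (free_seq i - free_seq j) = D i j" for i j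
  proof -
    have "\<alpha> (free_seq i - free_seq j) \<otimes> D j 0 = D i j \<otimes> D j 0"
      using \<alpha>_add[of "free_seq i - free_seq j" "free_seq j"] by (simp add: \<alpha>_seq D_mult)
    then show ?thesis
      by simp
  qed
  \<comment> \<open>Write \<open>s i\<close> as \<open>D i 0\<close> times \<open>s 0\<close>.
    Moving \<open>D i 0\<close> past the \<open>j + 1\<close> factors \<open>s 0\<close> lowers both
    indices by \<open>j + 1\<close>, which gives the indices in \<open>seq_solution\<close>.\<close>
  have "s i \<otimes> s 0 [^] j = s 0 [^] (j + 1) \<otimes> \<alpha> (free_seq (i - j - 1) - free_seq (- j - 1))" for i j
  proof -
    have "s i \<otimes> s 0 [^] j = D i 0 \<otimes> s 0 [^] (1 + j)"
      using s by (simp add: int_pow_mult m_assoc[symmetric] D_s)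
    then show ?thesis
      by (simp add: shift_pow \<alpha>_diff diff_diff_eq add.commute minus_diff_commute)
  qed
  with hom \<alpha>_frag[unfolded D_def] show ?thesis
    by (rule that)
qed

section \<open>Retraction classes and the basic identities of a solution\<close>

text \<open>No solution axioms are assumed, so this also applies to \<open>retraction S\<close>,
  which is never shown to be a solution here.\<close>

lemma ret_rel_all:
  assumes "card (carrier (retraction S)) = 1" "x \<in> carrier S" "y \<in> carrier S"
  shows "(x, y) \<in> ret_rel S"
proof -
  have "ret_rel S `` {x} \<in> carrier (retraction S)" "ret_rel S `` {y} \<in> carrier (retraction S)"
    using assms by (auto simp: retraction_def quotientI)
  with assms(1) have "ret_rel S `` {x} = ret_rel S `` {y}"
    by (metis card_1_singletonE singletonD)
  moreover have "y \<in> ret_rel S `` {y}"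
    using assms by (simp add: ret_rel_def)
  ultimately show ?thesis
    by blast
qed

context ybe_solution
begin

text \<open>The retraction is defined through \<open>tau\<close>, homomorphisms through
  \<open>sigma\<close>. On the carrier both give the same relation, see
  \<open>ret_rel_iff\<close>.\<close>

definition same_sigma :: "'a \<Rightarrow> 'a \<Rightarrow> bool"  (infix "\<doteq>" 50)
  where "x \<doteq> y \<longleftrightarrow> (\<forall>z \<in> carrier S. sigma S x z = sigma S y z)"

lemma same_sigma_refl [simp]: "x \<doteq> x"
  and same_sigma_sym: "x \<doteq> y \<Longrightarrow> y \<doteq> x"
  and same_sigma_trans [trans]: "x \<doteq> y \<Longrightarrow> y \<doteq> z \<Longrightarrow> x \<doteq> z"
  by (auto simp: same_sigma_def)

lemma sigma_closed [simp]: "x \<in> carrier S \<Longrightarrow> y \<in> carrier S \<Longrightarrow> sigma S x y \<in> carrier S"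
  using bij_sigma bij_betwE by blast

lemma tau_closed [simp]: "x \<in> carrier S \<Longrightarrow> y \<in> carrier S \<Longrightarrow> tau S x y \<in> carrier S"
  using bij_tau bij_betwE by blast

lemma sigma_cancel [simp]:
  assumes "x \<in> carrier S" "y \<in> carrier S" "z \<in> carrier S"
  shows "sigma S x y = sigma S x z \<longleftrightarrow> y = z"
  using bij_sigma[OF assms(1)] assms by (auto simp: bij_betw_def inj_on_eq_iff)

lemma tau_cancel [simp]:
  assumes "x \<in> carrier S" "y \<in> carrier S" "z \<in> carrier S"
  shows "tau S x y = tau S x z \<longleftrightarrow> y = z"
  using bij_tau[OF assms(1)] assms by (auto simp: bij_betw_def inj_on_eq_iff)

lemma sigma_surj:
  assumes "x \<in> carrier S" "y \<in> carrier S"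
  obtains z where "z \<in> carrier S" "sigma S x z = y"
  using bij_sigma[OF assms(1)] assms(2) by (metis bij_betw_imp_surj_on imageE)

lemma tau_surj:
  assumes "x \<in> carrier S" "y \<in> carrier S"
  obtains z where "z \<in> carrier S" "tau S x z = y"
  using bij_tau[OF assms(1)] assms(2) by (metis bij_betw_imp_surj_on imageE)

lemma sigma_tau: "x \<in> carrier S \<Longrightarrow> y \<in> carrier S \<Longrightarrow> sigma S (sigma S x y) (tau S y x) = x"
  and tau_sigma: "x \<in> carrier S \<Longrightarrow> y \<in> carrier S \<Longrightarrow> tau S (tau S y x) (sigma S x y) = y"
  using involutive[of "(x, y)"] by (simp_all add: ybe_map_def)

text \<open>This is the first component of the braid relation; \<open>tau_tau\<close> is the
  third.\<close>

lemma sigma_sigma: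
  assumes "x \<in> carrier S" "y \<in> carrier S" "z \<in> carrier S"
  shows "sigma S x (sigma S y z) = sigma S (sigma S x y) (sigma S (tau S y x) z)"
  using braid[of "(x, y, z)"] assms by (simp add: apply12_def apply23_def ybe_map_def)

lemma tau_tau:
  assumes "x \<in> carrier S" "y \<in> carrier S" "z \<in> carrier S"
  shows "tau S z (tau S y x) = tau S (tau S z y) (tau S (sigma S y z) x)"
  using braid[of "(x, y, z)"] assms by (simp add: apply12_def apply23_def ybe_map_def)

text \<open>
  The bijection $T(u) = \tau_u^{-1}(u)$, whose inverse is $a \mapsto \sigma_a^{-1}(a)$, satisfies
  $\tau_x T \sigma_x = T$. Hence $\sigma_x$ and $\tau_x$ determine each other.
\<close>

definition diag :: "'a \<Rightarrow> 'a"
  where "diag u = (THE a. a \<in> carrier S \<and> tau S u a = u)"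

lemma diag_closed [simp]: "u \<in> carrier S \<Longrightarrow> diag u \<in> carrier S"
  and tau_diag: "u \<in> carrier S \<Longrightarrow> tau S u (diag u) = u"
proof -
  assume u: "u \<in> carrier S"
  obtain a where "a \<in> carrier S" "tau S u a = u"
    using tau_surj[OF u u] by blast
  with u have "\<exists>!a. a \<in> carrier S \<and> tau S u a = u"
    by (metis tau_cancel)
  from theI'[OF this] show "diag u \<in> carrier S" "tau S u (diag u) = u"
    by (simp_all add: diag_def)
qed

lemma diag_unique:
  assumes "u \<in> carrier S" "a \<in> carrier S" "tau S u a = u"
  shows "diag u = a"
  using assms tau_diag tau_cancel diag_closed by metis

text \<open>Applying r twice to \<open>(diag u, u)\<close> shows that \<open>tau S u\<close> sends
  the left-hand side to \<open>u\<close>, which characterizes \<open>diag u\<close>. So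
  \<open>u\<close> can be recovered from \<open>diag u\<close>.\<close>

lemma sigma_diag:
  assumes u: "u \<in> carrier S"
  shows "sigma S (diag u) u = diag u"
  using u tau_sigma[of "diag u" u] tau_diag[OF u] diag_unique[of u "sigma S (diag u) u"] by simp

lemma diag_cancel:
  assumes "u \<in> carrier S" "v \<in> carrier S" "diag u = diag v"
  shows "u = v"
  using assms sigma_diag sigma_cancel diag_closed by metis

lemma diag_surj:
  assumes a: "a \<in> carrier S"
  obtains u where "u \<in> carrier S" "diag u = a"
proof -
  from a obtain u where u: "u \<in> carrier S" "sigma S a u = a"
    by (metis sigma_surj)
  then have "sigma S a (tau S u a) = sigma S a u"
    using sigma_tau[of a u] a by simp
  then have "tau S u a = u"
    using sigma_cancel[OF a tau_closed[OF u(1) a] u(1)] by blast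
  then show ?thesis
    using that diag_unique u a by blast
qed

lemma tau_diag_sigma:
  assumes "x \<in> carrier S" "y \<in> carrier S"
  shows "tau S x (diag (sigma S x y)) = diag y"
proof -
  \<comment> \<open>It suffices that \<open>tau S y\<close> sends the left-hand side to
    \<open>y\<close>. The exchange rule turns the inner index into \<open>sigma S x y\<close>,
    exactly where \<open>tau_diag\<close> applies.\<close>
  have "tau S y (tau S x (diag (sigma S x y))) =
      tau S (tau S y x) (tau S (sigma S x y) (diag (sigma S x y)))"
    using assms by (intro tau_tau) auto
  also have "\<dots> = y"
    using assms by (simp add: tau_diag tau_sigma)
  finally show ?thesis
    using assms by (intro diag_unique[symmetric]) auto
qed

lemma same_sigma_iff_tau:
  assumes x: "x \<in> carrier S" and y: "y \<in> carrier S"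
  shows "x \<doteq> y \<longleftrightarrow> (\<forall>z \<in> carrier S. tau S x z = tau S y z)"
proof
  assume xy: "x \<doteq> y"
  show "\<forall>z \<in> carrier S. tau S x z = tau S y z"
  proof
    fix z assume "z \<in> carrier S"
    then obtain w where w: "w \<in> carrier S" "diag (sigma S x w) = z"
      using x by (metis diag_surj sigma_surj)
    then have "diag (sigma S y w) = z"
      using xy by (simp add: same_sigma_def)
    then show "tau S x z = tau S y z"
      using w x y tau_diag_sigma by metis
  qed
next
  assume eq: "\<forall>z \<in> carrier S. tau S x z = tau S y z"
  have "sigma S x z = sigma S y z" if z: "z \<in> carrier S" for z
  proof -
    have "tau S x (diag (sigma S x z)) = tau S x (diag (sigma S y z))"
      using eq x y z by (simp add: tau_diag_sigma)
    then show ?thesis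
      using x y z by (simp add: diag_cancel)
  qed
  then show "x \<doteq> y"
    by (simp add: same_sigma_def)
qed

section \<open>The retraction relation as a congruence\<close>

lemma ret_rel_iff: "(x, y) \<in> ret_rel S \<longleftrightarrow> x \<in> carrier S \<and> y \<in> carrier S \<and> x \<doteq> y"
  using same_sigma_iff_tau by (auto simp: ret_rel_def)

lemma tau_cong_left:
  assumes "x \<doteq> y" "x \<in> carrier S" "y \<in> carrier S" "z \<in> carrier S"
  shows "tau S x z = tau S y z"
  using assms same_sigma_iff_tau by blast

text \<open>In \<open>sigma_sigma\<close> the left-hand side and the outer index on the right depend
  only on the class of \<open>x\<close>; cancelling the outer permutation leaves the claim. The dual
  argument with \<open>tau_tau\<close> proves \<open>same_sigma_sigma\<close>.\<close>

lemma same_sigma_tau: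
  assumes "x \<doteq> y" "x \<in> carrier S" "y \<in> carrier S" "z \<in> carrier S"
  shows "tau S z x \<doteq> tau S z y"
  unfolding same_sigma_def
proof
  fix w assume "w \<in> carrier S"
  then show "sigma S (tau S z x) w = sigma S (tau S z y) w"
    using assms sigma_sigma[of x z w] sigma_sigma[of y z w] by (simp add: same_sigma_def)
qed

lemma same_sigma_sigma:
  assumes "x \<doteq> y" "x \<in> carrier S" "y \<in> carrier S" "z \<in> carrier S"
  shows "sigma S z x \<doteq> sigma S z y"
proof -
  have "tau S (sigma S z x) w = tau S (sigma S z y) w" if "w \<in> carrier S" for w
  proof -
    have "tau S (tau S x z) (tau S (sigma S z x) w) = tau S (tau S x z) (tau S (sigma S z y) w)"
      using assms that tau_tau[of w z x] tau_tau[of w z y] tau_cong_left[of x y] by simp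
    then show ?thesis
      using assms that by simp
  qed
  then show ?thesis
    using assms by (simp add: same_sigma_iff_tau)
qed

text \<open>By involutivity, \<open>sigma S ?a\<close> sends both \<open>tau S x z\<close> and
  \<open>tau S y z\<close> to \<open>z\<close>, so they are one element t. Then \<open>x\<close> and
  \<open>y\<close> are the images of \<open>?a\<close> and \<open>?b\<close> under
  \<open>tau S t\<close>, which respects classes.\<close>

lemma same_sigma_sigmaD:
  assumes "sigma S z x \<doteq> sigma S z y" and C: "x \<in> carrier S" "y \<in> carrier S" "z \<in> carrier S"
  shows "x \<doteq> y"
proof -
  let ?a = "sigma S z x" and ?b = "sigma S z y"
  have "sigma S ?a (tau S x z) = sigma S ?a (tau S y z)"
    using assms sigma_tau[of z x] sigma_tau[of z y] by (simp add: same_sigma_def)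
  then have "tau S (tau S x z) ?b = y"
    using C tau_sigma[of z y] by simp
  then show ?thesis
    using same_sigma_tau[OF assms(1), of "tau S x z"] C tau_sigma[of z x] by simp
qed

lemma same_sigma_tauD:
  assumes "tau S z x \<doteq> tau S z y" and C: "x \<in> carrier S" "y \<in> carrier S" "z \<in> carrier S"
  shows "x \<doteq> y"
proof -
  let ?a = "tau S z x" and ?b = "tau S z y"
  have "tau S ?a (sigma S x z) = tau S ?a (sigma S y z)"
    using C tau_cong_left[OF assms(1), of "sigma S y z"] tau_sigma[of x z] tau_sigma[of y z] by simp
  then have "sigma S (sigma S x z) ?b = y"
    using C sigma_tau[of y z] by simp
  then show ?thesis
    using same_sigma_sigma[OF assms(1), of "sigma S x z"] C sigma_tau[of x z] by simp
qed

section \<open>Level at most 2: the action on classes does not depend on the index\<close>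

lemma level_le_2_tau:
  assumes "mp_level_1 S \<or> mp_level_2 S" and C: "x \<in> carrier S" "y \<in> carrier S" "z \<in> carrier S"
  shows "tau S x z \<doteq> tau S y z"
  using assms(1)
proof
  assume "mp_level_1 S"
  then have "(x, y) \<in> ret_rel S"
    using C by (intro ret_rel_all) (auto simp: mp_level_1_def)
  then show ?thesis
    using C by (simp add: ret_rel_def)
next
  let ?R = "retraction S" and ?c = "\<lambda>x. ret_rel S `` {x}"
  assume "mp_level_2 S"
  moreover have cls: "?c x \<in> carrier ?R" if "x \<in> carrier S" for x
    using that by (auto simp: retraction_def quotientI)
  ultimately have "(?c x, ?c y) \<in> ret_rel ?R"
    using C by (intro ret_rel_all) (auto simp: mp_level_2_def)
  then have eq: "tau ?R (?c x) (?c z) = tau ?R (?c y) (?c z)"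
    using cls[OF \<open>z \<in> carrier S\<close>] by (simp add: ret_rel_def)
  \<comment> \<open>The operations of the retraction are unions over representatives. Following one
    element through the union avoids evaluating it to a single class.\<close>
  have "tau S x z \<in> tau ?R (?c x) (?c z)"
    unfolding retraction_def using C
    by (simp add: ret_rel_iff) (rule bexI[of _ x], rule bexI[of _ z], simp_all add: ret_rel_iff)
  then obtain y' z' where y': "y' \<in> carrier S" "y \<doteq> y'" and z': "z' \<in> carrier S" "z \<doteq> z'"
    and "tau S y' z' \<doteq> tau S x z"
    unfolding eq by (auto simp: retraction_def ret_rel_iff)
  moreover have "tau S y z \<doteq> tau S y' z'"
    using y' z' C same_sigma_tau[of z z' y'] tau_cong_left[of y y' z] by simp
  ultimately show ?thesis
    using same_sigma_sym same_sigma_trans by blast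
qed

text \<open>Involutivity recovers \<open>z\<close> from either pair \<open>(x, z)\<close>,
  \<open>(y, z)\<close> by a \<open>tau\<close> map. By the previous lemma the two maps agree on
  classes, where they can be cancelled.\<close>

lemma level_le_2_sigma:
  assumes "mp_level_1 S \<or> mp_level_2 S" and C: "x \<in> carrier S" "y \<in> carrier S" "z \<in> carrier S"
  shows "sigma S x z \<doteq> sigma S y z"
proof -
  have "tau S (tau S z x) (sigma S x z) = tau S (tau S z y) (sigma S y z)"
    using C by (simp add: tau_sigma)
  moreover have "tau S (tau S z y) (sigma S y z) \<doteq> tau S (tau S z x) (sigma S y z)"
    using C by (intro level_le_2_tau assms(1)) auto
  ultimately have "tau S (tau S z x) (sigma S x z) \<doteq> tau S (tau S z x) (sigma S y z)"
    by simp
  then show ?thesis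
    by (rule same_sigma_tauD) (use C in auto)
qed

section \<open>Permutations of the carrier and transitivity\<close>

definition perm :: "'a \<Rightarrow> 'a \<Rightarrow> 'a"
  where "perm x = restrict (sigma S x) (carrier S)"

lemma perm_apply [simp]: "z \<in> carrier S \<Longrightarrow> perm x z = sigma S x z"
  by (simp add: perm_def)

lemma perm_in_BijGroup [simp]: "x \<in> carrier S \<Longrightarrow> perm x \<in> carrier (BijGroup (carrier S))"
  using bij_sigma[of x] by (simp add: perm_def BijGroup_def Bij_def)

end

lemma BijGroup_mult_apply:
  "f \<in> carrier (BijGroup A) \<Longrightarrow> g \<in> carrier (BijGroup A) \<Longrightarrow> x \<in> A \<Longrightarrow>
    (f \<otimes>\<^bsub>BijGroup A\<^esub> g) x = f (g x)"
  by (simp add: BijGroup_def compose_def)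

lemma BijGroup_closed: "f \<in> carrier (BijGroup A) \<Longrightarrow> x \<in> A \<Longrightarrow> f x \<in> A"
  by (auto simp: BijGroup_def dest: Bij_imp_funcset)

lemma BijGroup_one_apply: "x \<in> A \<Longrightarrow> \<one>\<^bsub>BijGroup A\<^esub> x = x"
  by (simp add: BijGroup_def)

lemma BijGroup_apply_inv:
  assumes "f \<in> carrier (BijGroup A)" "x \<in> A"
  shows "f ((inv\<^bsub>BijGroup A\<^esub> f) x) = x" "(inv\<^bsub>BijGroup A\<^esub> f) (f x) = x"
proof -
  interpret group "BijGroup A" by (rule group_BijGroup)
  show "f ((inv\<^bsub>BijGroup A\<^esub> f) x) = x" "(inv\<^bsub>BijGroup A\<^esub> f) (f x) = x"
    using assms BijGroup_mult_apply[of f A "inv\<^bsub>BijGroup A\<^esub> f" x]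
      BijGroup_mult_apply[of "inv\<^bsub>BijGroup A\<^esub> f" A f x]
    by (simp_all add: BijGroup_one_apply)
qed

lemma BijGroup_ext:
  assumes "f \<in> carrier (BijGroup A)" "g \<in> carrier (BijGroup A)" "\<And>x. x \<in> A \<Longrightarrow> f x = g x"
  shows "f = g"
  using assms by (auto simp: BijGroup_def Bij_def intro: extensionalityI)

text \<open>The equivalence in the last hypothesis handles inverses of generators: on an infinite
  carrier, invariance in one direction does not imply the other. The lemma serves once for a union
  of classes and once for the range of the epimorphism.\<close>

lemma (in ybe_solution) indecomposable_invariant_subset:
  assumes "indecomposable S" "e \<in> Q" "Q \<subseteq> carrier S"
    and Q: "\<And>x z. x \<in> carrier S \<Longrightarrow> z \<in> carrier S \<Longrightarrow> sigma S x z \<in> Q \<longleftrightarrow> z \<in> Q"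
  shows "Q = carrier S"
proof -
  let ?P = "BijGroup (carrier S)"
  interpret P: group ?P by (rule group_BijGroup)
  let ?K = "perm ` carrier S"
  have *: "g \<in> carrier ?P \<and> (\<forall>z \<in> Q. g z \<in> Q)" if "g \<in> generate ?P ?K" for g
    using that
  proof induction
    case (inv h)
    then obtain x where x: "x \<in> carrier S" "h = perm x"
      by blast
    have "(inv\<^bsub>?P\<^esub> h) z \<in> Q" if z: "z \<in> Q" for z
    proof -
      let ?w = "(inv\<^bsub>?P\<^esub> h) z"
      have zC: "z \<in> carrier S"
        using z assms by auto
      have w: "?w \<in> carrier S"
        by (rule BijGroup_closed[OF P.inv_closed zC]) (simp add: x)
      have "h ?w = z"
        by (rule BijGroup_apply_inv) (simp_all add: x zC)
      then have "sigma S x ?w = z"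
        using x w by simp
      then show ?thesis
        using Q[of x ?w] x w z by simp
    qed
    then show ?case
      using x by simp
  next
    case (eng g h)
    then show ?case
      using assms(3) BijGroup_mult_apply[of g _ h] by (auto simp: subset_iff)
  qed (use assms in \<open>auto simp: BijGroup_one_apply subset_iff\<close>)
  show ?thesis
  proof
    show "carrier S \<subseteq> Q"
    proof
      fix y assume "y \<in> carrier S"
      moreover have "transitive_action (permutation_group S) (carrier S) (\<lambda>g. g)"
        using assms by (simp add: indecomposable_def)
      ultimately obtain g where "g \<in> carrier (permutation_group S)" "g e = y"
        using transitive_action.unique_orbit assms by (metis subset_iff)
      then show "y \<in> Q"
        using * assms by (auto simp: permutation_group_def perm_def)
    qed
  qed fact
qed

section \<open>Construction of the epimorphism\<close>

theorem (in ybe_solution) homomorphic_image_free_seq: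
  assumes "indecomposable S" and level_le_2: "mp_level_1 S \<or> mp_level_2 S"
  shows "homomorphic_image S (seq_solution free_seq)"
proof -
  let ?C = "carrier S"
  let ?P = "BijGroup ?C"
  interpret P: group ?P by (rule group_BijGroup)
  have closed [simp]: "f z \<in> ?C" if "f \<in> carrier ?P" "z \<in> ?C" for f z
    using that by (rule BijGroup_closed)
  note apply_simps = BijGroup_mult_apply BijGroup_one_apply BijGroup_apply_inv
  note level = level_le_2_sigma[OF level_le_2]
  obtain e where e: "e \<in> ?C"
    using nonempty by blast
  define x where "x i = (perm e [^]\<^bsub>?P\<^esub> i) e" for i :: int
  have x [simp]: "x i \<in> ?C" for i
    using e by (simp add: x_def)
  have x_Suc: "x (i + 1) = sigma S e (x i)" for i
    using e P.int_pow_mult[of "perm e" 1 i]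
    by (simp add: x_def BijGroup_mult_apply add.commute)
  \<comment> \<open>On classes \<open>sigma S y\<close> acts like \<open>sigma S e\<close>, which
    sends \<open>x i\<close> to \<open>x (i + 1)\<close>.\<close>
  have sigma_x: "sigma S y z \<doteq> x (i + 1)"
    if "y \<in> ?C" "z \<in> ?C" "z \<doteq> x i" for y z i
    using that same_sigma_sigma[of z "x i" y] level[of y e "x i"] e same_sigma_trans
    by (simp add: x_Suc)
  have sigma_xD: "z \<doteq> x i"
    if "y \<in> ?C" "z \<in> ?C" "sigma S y z \<doteq> x (i + 1)" for y z i
  proof -
    have "sigma S y z \<doteq> sigma S y (x i)"
      by (rule same_sigma_trans[OF that(3) same_sigma_sym[OF sigma_x[OF that(1) x same_sigma_refl]]])
    then show ?thesis
      by (rule same_sigma_sigmaD) (use that in auto)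
  qed
  have all_x: "\<exists>i. z \<doteq> x i" if "z \<in> ?C" for z
  proof -
    have "{z \<in> ?C. \<exists>i. z \<doteq> x i} = ?C"
    proof (rule indecomposable_invariant_subset[OF assms(1)])
      show "x 0 \<in> {z \<in> ?C. \<exists>i. z \<doteq> x i}"
        using same_sigma_refl[of "x 0"] x[of 0] by blast
      fix y z assume C: "y \<in> ?C" "z \<in> ?C"
      have "z \<doteq> x (i - 1)" if "sigma S y z \<doteq> x i" for i
        by (rule sigma_xD[OF C]) (use that in simp)
      then show "sigma S y z \<in> {z \<in> ?C. \<exists>i. z \<doteq> x i} \<longleftrightarrow> z \<in> {z \<in> ?C. \<exists>i. z \<doteq> x i}"
        using C sigma_x[OF C] sigma_closed[OF C] by blast
    qed auto
    with that show ?thesis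
      by blast
  qed
  \<comment> \<open>By \<open>sigma_tau\<close> some \<open>sigma\<close> map sends
    \<open>tau S y (x i)\<close> to \<open>x i\<close>, so its class has index one lower.\<close>
  have tau_x: "tau S y (x i) \<doteq> x (i - 1)" if "y \<in> ?C" for y i
    by (rule sigma_xD[of "sigma S (x i) y"]) (use that sigma_tau[of "x i" y] in auto)
  define s where "s i = perm (x i)" for i
  have s [simp]: "s i \<in> carrier ?P" for i
    by (simp add: s_def)
  have s_apply: "s i z = sigma S y z" if "y \<in> ?C" "z \<in> ?C" "y \<doteq> x i" for i y z
    using that by (simp add: s_def same_sigma_def)
  have rel: "s i \<otimes>\<^bsub>?P\<^esub> s j = s (j + 1) \<otimes>\<^bsub>?P\<^esub> s (i - 1)" for i j
  proof (rule BijGroup_ext)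
    fix z assume z: "z \<in> ?C"
    have "(s i \<otimes>\<^bsub>?P\<^esub> s j) z = sigma S (x i) (sigma S (x j) z)"
      using z by (simp add: apply_simps s_def)
    also have "\<dots> = sigma S (sigma S (x i) (x j)) (sigma S (tau S (x j) (x i)) z)"
      by (rule sigma_sigma) (use z in auto)
    also have "\<dots> = s (j + 1) (s (i - 1) z)"
      using z s_apply[OF _ _ tau_x[of "x j" i]] s_apply[OF _ _ sigma_x[of "x i" "x j" j]] by simp
    finally show "(s i \<otimes>\<^bsub>?P\<^esub> s j) z = (s (j + 1) \<otimes>\<^bsub>?P\<^esub> s (i - 1)) z"
      using z by (simp add: apply_simps)
  qed auto
  obtain \<alpha> where hom: "\<alpha> \<in> hom (free_Abelian_group UNIV) ?P"
    and \<alpha>_frag: "\<And>i. \<alpha> (frag_of i) = s i \<otimes>\<^bsub>?P\<^esub> inv\<^bsub>?P\<^esub> s (i - 1)"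
    and \<alpha>_shift: "\<And>i j. s i \<otimes>\<^bsub>?P\<^esub> s 0 [^]\<^bsub>?P\<^esub> j =
      s 0 [^]\<^bsub>?P\<^esub> (j + 1) \<otimes>\<^bsub>?P\<^esub> \<alpha> (free_seq (i - j - 1) - free_seq (- j - 1))"
    using P.exchange_sequence_hom[OF s rel] by blast
  interpret \<alpha>: group_hom "free_Abelian_group UNIV" ?P \<alpha>
    by (simp add: group_hom_def group_hom_axioms_def hom P.is_group)
  have \<alpha>_closed [simp]: "\<alpha> b \<in> carrier ?P" for b
    using \<alpha>.hom_closed[of b] by simp
  have \<alpha>_add: "\<alpha> (a + b) = \<alpha> a \<otimes>\<^bsub>?P\<^esub> \<alpha> b" for a b
    using \<alpha>.hom_mult[of a b] by simp
  have \<alpha>_zero: "\<alpha> 0 = \<one>\<^bsub>?P\<^esub>"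
    using \<alpha>.hom_one by simp
  \<comment> \<open>For a basis element, \<open>s i\<close> and \<open>s (i - 1)\<close> send each
    point to equivalent points, by the level hypothesis. This keeps \<open>\<Phi> (b, j)\<close> in
    the class of \<open>x j\<close>.\<close>
  have \<alpha>_class: "\<forall>z \<in> ?C. \<alpha> b z \<doteq> z" for b
  proof (rule frag_induction[where S = UNIV])
    show "\<forall>z \<in> ?C. \<alpha> (frag_of i) z \<doteq> z" for i
    proof
      fix z assume z: "z \<in> ?C"
      define w where "w = (inv\<^bsub>?P\<^esub> s (i - 1)) z"
      have w: "w \<in> ?C" "s (i - 1) w = z"
        using z by (simp_all add: w_def apply_simps)
      have "\<alpha> (frag_of i) z = s i w"
        using z by (simp add: \<alpha>_frag w_def apply_simps)
      moreover have "s i w \<doteq> s (i - 1) w"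
        using w level[of "x i" "x (i - 1)" w] by (simp add: s_def)
      ultimately show "\<alpha> (frag_of i) z \<doteq> z"
        using w by simp
    qed
    show "\<forall>z \<in> ?C. \<alpha> (a - b) z \<doteq> z"
      if "\<forall>z \<in> ?C. \<alpha> a z \<doteq> z" "\<forall>z \<in> ?C. \<alpha> b z \<doteq> z" for a b
    proof
      fix z assume z: "z \<in> ?C"
      \<comment> \<open>As \<open>\<alpha> b\<close> sends \<open>w\<close> to \<open>z\<close>, the
        hypothesis on \<open>b\<close>, applied at \<open>w\<close>, gives that \<open>w\<close> and
        \<open>z\<close> are equivalent.\<close>
      define w where "w = \<alpha> (- b) z"
      have w: "w \<in> ?C"
        using z by (simp add: w_def)
      have "\<alpha> b \<otimes>\<^bsub>?P\<^esub> \<alpha> (- b) = \<one>\<^bsub>?P\<^esub>"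
        using \<alpha>_add[of b "- b"] by (simp add: \<alpha>_zero)
      then have "\<alpha> b w = z"
        using z BijGroup_mult_apply[of "\<alpha> b" ?C "\<alpha> (- b)" z]
        by (simp add: w_def BijGroup_one_apply)
      moreover have "\<alpha> (a - b) z = \<alpha> a w"
        using z \<alpha>_add[of a "- b"] by (simp add: w_def BijGroup_mult_apply)
      ultimately show "\<alpha> (a - b) z \<doteq> z"
        using that w same_sigma_sym same_sigma_trans by metis
    qed
  qed (auto simp: \<alpha>_zero apply_simps)
  define \<Phi> where "\<Phi> = (\<lambda>(b, j :: int). (s 0 [^]\<^bsub>?P\<^esub> j) (\<alpha> b e))"
  have \<Phi>_closed [simp]: "\<Phi> p \<in> ?C" for p
    using closed[OF P.int_pow_closed[OF s] closed[OF \<alpha>_closed e]]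
    by (simp add: \<Phi>_def split: prod.splits)
  have s_\<Phi>: "s i (\<Phi> (b, j)) = \<Phi> (b + free_seq (i - j - 1) - free_seq (- j - 1), j + 1)" for i b j
  proof -
    let ?c = "free_seq (i - j - 1) - free_seq (- j - 1)"
    have "s i (\<Phi> (b, j)) = (s i \<otimes>\<^bsub>?P\<^esub> s 0 [^]\<^bsub>?P\<^esub> j) (\<alpha> b e)"
      using e by (simp add: \<Phi>_def apply_simps)
    also have "\<dots> = (s 0 [^]\<^bsub>?P\<^esub> (j + 1)) ((\<alpha> ?c \<otimes>\<^bsub>?P\<^esub> \<alpha> b) e)"
      using e by (simp add: \<alpha>_shift apply_simps)
    also have "\<dots> = \<Phi> (?c + b, j + 1)"
      by (simp add: \<Phi>_def \<alpha>_add)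
    finally show ?thesis
      by (simp add: algebra_simps)
  qed
  \<comment> \<open>For \<open>i = 0\<close> the two members of \<open>free_seq\<close> in
    \<open>s_\<Phi>\<close> coincide and cancel.\<close>
  have s_0_\<Phi>: "sigma S (x 0) (\<Phi> (b, j)) = \<Phi> (b, j + 1)" for b j
    using s_\<Phi>[of 0 b j] by (simp add: s_def)
  have \<Phi>_class: "\<Phi> (b, j) \<doteq> x j" for b j
  proof (induction j rule: int_induct[where k = 0])
    case base
    then show ?case
      using \<alpha>_class[of b] e by (simp add: \<Phi>_def x_def apply_simps)
  next
    case (step1 j)
    then show ?case
      using sigma_x[of "x 0" "\<Phi> (b, j)" j] by (simp add: s_0_\<Phi>)
  next
    case (step2 j)
    then show ?case
      using sigma_xD[of "x 0" "\<Phi> (b, j - 1)" "j - 1"] by (simp add: s_0_\<Phi>)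
  qed
  have "ybe_hom (seq_solution free_seq) S \<Phi>"
    unfolding ybe_hom_def
  \<comment> \<open>Since \<open>\<Phi> (a, i)\<close> lies in the class of \<open>x i\<close>, its
    \<open>sigma\<close> map is \<open>s i\<close>, and \<open>s_\<Phi>\<close> is the homomorphism
    law.\<close>
  proof (intro conjI ballI)
    fix p q :: "(int \<Rightarrow>\<^sub>0 int) \<times> int"
    obtain a i b j where "p = (a, i)" "q = (b, j)"
      by (metis surj_pair)
    then show "\<Phi> (sigma (seq_solution free_seq) p q) = sigma S (\<Phi> p) (\<Phi> q)"
      using s_\<Phi>[of i b j] s_apply[of "\<Phi> (a, i)" "\<Phi> (b, j)" i] \<Phi>_class[of a i]
      by (simp add: seq_solution_def)
  qed simp
  moreover have "range \<Phi> = ?C"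
  proof (rule indecomposable_invariant_subset[OF assms(1) rangeI])
    fix y z assume y: "y \<in> ?C" and z: "z \<in> ?C"
    obtain i where "y \<doteq> x i"
      using all_x y by blast
    then have sz: "sigma S y z = s i z"
      using s_apply y z by metis
    show "sigma S y z \<in> range \<Phi> \<longleftrightarrow> z \<in> range \<Phi>"
    proof
      assume "sigma S y z \<in> range \<Phi>"
      then obtain b j where "s i z = \<Phi> (b, j)"
        using sz by (metis imageE surj_pair)
      \<comment> \<open>The witness comes from solving \<open>s_\<Phi>\<close> at
        \<open>j - 1\<close> for the first coordinate; injectivity of \<open>s i\<close> then
        identifies \<open>z\<close>.\<close>
      then have "s i z = s i (\<Phi> (b - free_seq (i - j) + free_seq (- j), j - 1))"
        by (simp add: s_\<Phi>)
      then show "z \<in> range \<Phi>"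
        using z by (simp add: s_def)
    next
      assume "z \<in> range \<Phi>"
      then show "sigma S y z \<in> range \<Phi>"
        using sz s_\<Phi> by auto
    qed
  qed auto
  ultimately show ?thesis
    by (auto simp: homomorphic_image_def seq_solution_def)
qed

theorem proposition5p1:
  fixes X :: "'a ybe"
  assumes "ybe_solution X"
    and "indecomposable X"
    and "mp_level_1 X \<or> mp_level_2 X"
  shows "homomorphic_image X (seq_solution free_seq)"
  using assms by (rule ybe_solution.homomorphic_image_free_seq)

end
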